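(* Let $\mathbf{X}\in\mathbb{R}^{n\times p}$ be a design matrix with no row equal to the zero vector, let $y\in\{0,1\}^n$ and $\mu_\beta\in\mathbb{R}^p$. For any $\alpha\in(0,1]$ and any positive definite $\Sigma_\beta\in\mathbb{R}^{p\times p}$, any fixed point solution $\xi^*$ of the EM sequence $$(\xi^{t+1})^2=\mathrm{diag}\big[\mathbf{X}\{\Sigma_\alpha(\xi^t)/\alpha+\mu_\alpha(\xi^t)\mu_\alpha^\top(\xi^t)\}\mathbf{X}^\top\big]$$ is locally asymptotically stable.
   Context: $A(t)=-\tanh(t/2)/(4t)$ with $A(0)=-1/8$, applied elementwise to vectors; $\mathbf{1}_n$ is the all-ones vector. For $\xi\in\mathbb{R}^n$, $$\Sigma_\alpha^{-1}(\xi)=\Sigma_\beta^{-1}/\alpha-2\mathbf{X}^\top\mathrm{diag}\{A(\xi)\}\mathbf{X},\qquad \mu_\alpha^\top(\xi)\Sigma_\alpha^{-1}(\xi)=(y-\tfrac12\mathbf{1}_n)^\top\mathbf{X}+\mu_\beta^\top\Sigma_\beta^{-1}/\alpha ,$$ where $\mathrm{diag}\{A(\xi)\}$ is the diagonal matrix with entries $A(\xi_i)$. In the EM recursion the square on the left is elementwise and $\mathrm{diag}[M]$ is the vector of diagonal entries of the $n\times n$ matrix $M$. A fixed point $\xi^*$ satisfies $(\xi^* )^2=\mathrm{diag}[\mathbf{X}\{\Sigma_\alpha(\xi^* )/\alpha+\mu_\alpha(\xi^* )\mu_\alpha^\top(\xi^* )\}\mathbf{X}^\top]$. Since $A$ is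 even, only $|\xi_i|$ matters, and $\xi$ is taken with nonnegative coordinates. The recursion is regarded as a discrete-time autonomous dynamical system $\psi^{t+1}=f(\psi^t)$ in the variable $\psi=\xi^2$ (elementwise square). A fixed point $\psi^*=f(\psi^* )$ of such a system is locally asymptotically stable if for any $\epsilon>0$ there is $\delta=\delta(\epsilon)>0$ such that whenever $\|\psi^0-\psi^*\|<\delta$ we have $\|f(\psi^t)-\psi^*\|<\epsilon$ for all $t$ and $\lim_{t\to\infty}\|\psi^t-\psi^*\|=0$. *)

theory Defs
  imports "HOL-Analysis.Analysis"
begin

definition positive_definite :: "real^'n^'n \<Rightarrow> bool" where
  "positive_definite M \<longleftrightarrow> transpose M = M \<and> (\<forall>v. v \<noteq> 0 \<longrightarrow> v \<bullet> (M *v v) > 0)"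

definition diag_matrix :: "real^'n \<Rightarrow> real^'n^'n" where
  "diag_matrix v = (\<chi> i j. if i = j then v $ i else 0)"

definition diag_entries :: "real^'n^'n \<Rightarrow> real^'n" where
  "diag_entries M = (\<chi> i. M $ i $ i)"

definition outer_prod :: "real^'n \<Rightarrow> real^'m \<Rightarrow> real^'m^'n" where
  "outer_prod u v = (\<chi> i j. u $ i * v $ j)"

definition vec_square :: "real^'n \<Rightarrow> real^'n" where
  "vec_square v = (\<chi> i. (v $ i)\<^sup>2)"

definition vec_sqrt :: "real^'n \<Rightarrow> real^'n" where
  "vec_sqrt v = (\<chi> i. sqrt (v $ i))"

definition A_fun :: "real \<Rightarrow> real" where
  "A_fun t = (if t = 0 then - 1 / 8 else - tanh (t / 2) / (4 * t))"

definition Sigma_inv ::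
  "real^'p^'n \<Rightarrow> real^'p^'p \<Rightarrow> real \<Rightarrow> real^'n \<Rightarrow> real^'p^'p" where
  "Sigma_inv X \<Sigma>\<^sub>\<beta> \<alpha> \<xi> =
     matrix_inv \<Sigma>\<^sub>\<beta> /\<^sub>R \<alpha>
     - 2 *\<^sub>R (transpose X ** diag_matrix (\<chi> i. A_fun (\<xi> $ i)) ** X)"

definition Sigma_mat ::
  "real^'p^'n \<Rightarrow> real^'p^'p \<Rightarrow> real \<Rightarrow> real^'n \<Rightarrow> real^'p^'p" where
  "Sigma_mat X \<Sigma>\<^sub>\<beta> \<alpha> \<xi> = matrix_inv (Sigma_inv X \<Sigma>\<^sub>\<beta> \<alpha> \<xi>)"

text \<open>The row vector \<open>\<mu>\<^sup>T\<close> is specified by the value of \<open>\<mu>\<^sup>T \<Sigma>\<^sup>-\<^sup>1\<close>; multiplying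
  by \<open>\<Sigma>\<close> from the right solves for it. Row-vector products are written with \<open>v*\<close>.\<close>

definition mu_vec ::
  "real^'p^'n \<Rightarrow> real^'n \<Rightarrow> real^'p \<Rightarrow> real^'p^'p \<Rightarrow> real \<Rightarrow> real^'n \<Rightarrow> real^'p" where
  "mu_vec X y \<mu>\<^sub>\<beta> \<Sigma>\<^sub>\<beta> \<alpha> \<xi> =
     ((y - (\<chi> i. 1 / 2)) v* X + (\<mu>\<^sub>\<beta> v* matrix_inv \<Sigma>\<^sub>\<beta>) /\<^sub>R \<alpha>) v* Sigma_mat X \<Sigma>\<^sub>\<beta> \<alpha> \<xi>"

definition em_rhs ::
  "real^'p^'n \<Rightarrow> real^'n \<Rightarrow> real^'p \<Rightarrow> real^'p^'p \<Rightarrow> real \<Rightarrow> real^'n \<Rightarrow> real^'n" where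
  "em_rhs X y \<mu>\<^sub>\<beta> \<Sigma>\<^sub>\<beta> \<alpha> \<xi> =
     diag_entries
       (X ** (Sigma_mat X \<Sigma>\<^sub>\<beta> \<alpha> \<xi> /\<^sub>R \<alpha>
              + outer_prod (mu_vec X y \<mu>\<^sub>\<beta> \<Sigma>\<^sub>\<beta> \<alpha> \<xi>) (mu_vec X y \<mu>\<^sub>\<beta> \<Sigma>\<^sub>\<beta> \<alpha> \<xi>))
          ** transpose X)"

text \<open>The recursion in the variable \<open>\<psi> = \<xi>\<^sup>2\<close>, with \<open>\<xi>\<close> the nonnegative square root.\<close>

definition em_map ::
  "real^'p^'n \<Rightarrow> real^'n \<Rightarrow> real^'p \<Rightarrow> real^'p^'p \<Rightarrow> real \<Rightarrow> real^'n \<Rightarrow> real^'n" where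
  "em_map X y \<mu>\<^sub>\<beta> \<Sigma>\<^sub>\<beta> \<alpha> \<psi> = em_rhs X y \<mu>\<^sub>\<beta> \<Sigma>\<^sub>\<beta> \<alpha> (vec_sqrt \<psi>)"

text \<open>Here \<open>S\<close> is the state space of the autonomous system \<open>\<psi> (t + 1) = f (\<psi> t)\<close>: only
  initial states in \<open>S\<close> are considered.\<close>

definition locally_asymptotically_stable ::
  "'a::real_normed_vector set \<Rightarrow> ('a \<Rightarrow> 'a) \<Rightarrow> 'a \<Rightarrow> bool" where
  "locally_asymptotically_stable S f \<psi>s \<longleftrightarrow>
     \<psi>s \<in> S \<and> f \<psi>s = \<psi>s \<and>
     (\<forall>\<epsilon>>0. \<exists>\<delta>>0. \<forall>\<psi> :: nat \<Rightarrow> 'a.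
        \<psi> 0 \<in> S \<and> (\<forall>t. \<psi> (Suc t) = f (\<psi> t)) \<and> norm (\<psi> 0 - \<psi>s) < \<delta> \<longrightarrow>
          (\<forall>t. norm (f (\<psi> t) - \<psi>s) < \<epsilon>) \<and> (\<lambda>t. norm (\<psi> t - \<psi>s)) \<longlonglongrightarrow> 0)"

end

theory Submission
  imports Defs
begin

text \<open>Write \<open>b\<^sub>i = - 2 A(\<xi>\<^sub>i) > 0\<close>, \<open>S = X \<Sigma>\<^sub>\<alpha> X\<^sup>T\<close> and \<open>m = X \<mu>\<^sub>\<alpha>\<close>, so that the recursion reads
  \<open>\<psi>\<^sub>i \<mapsto> S\<^sub>i\<^sub>i / \<alpha> + m\<^sub>i\<^sup>2\<close>. Its derivative is \<open>- P diag(db/d\<psi>)\<close> with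
  \<open>P\<^sub>i\<^sub>j = S\<^sub>i\<^sub>j\<^sup>2 / \<alpha> + 2 m\<^sub>i S\<^sub>i\<^sub>j m\<^sub>j\<close>. By the Schur product theorem \<open>P\<close> is positive semidefinite, and
  \<open>S \<le> diag(1 / b)\<close> yields \<open>P \<le> diag((S\<^sub>i\<^sub>i / \<alpha> + 2 m\<^sub>i\<^sup>2) / b\<^sub>i) \<le> diag(2 \<psi>\<^sub>i / b\<^sub>i)\<close> at a fixed point.
  Since \<open>2 \<psi>\<^sub>i |db\<^sub>i/d\<psi>\<^sub>i| < b\<^sub>i\<close>, the derivative is a strict contraction for the squared norm
  \<open>\<Sum>\<^sub>i b\<^sub>i u\<^sub>i\<^sup>2 / (2 \<psi>\<^sub>i)\<close>. The fixed point has positive coordinates because no row of \<open>X\<close> vanishes.\<close>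

section \<open>Quadratic forms and the Schur product theorem\<close>

definition positive_semidefinite :: "real^'n^'n \<Rightarrow> bool" where
  "positive_semidefinite M \<longleftrightarrow> transpose M = M \<and> (\<forall>v. 0 \<le> v \<bullet> (M *v v))"

definition hadamard :: "real^'n^'n \<Rightarrow> real^'n^'n \<Rightarrow> real^'n^'n" where
  "hadamard M N = (\<chi> i j. M $ i $ j * N $ i $ j)"

lemma inner_matrix_vector: "u \<bullet> (M *v v) = (\<Sum>i\<in>UNIV. \<Sum>j\<in>UNIV. u $ i * M $ i $ j * v $ j)"
  for M :: "real^'m^'n"
  by (simp add: inner_vec_def matrix_vector_mult_def sum_distrib_left mult.assoc)

lemma inner_transpose_matrix_vector: "u \<bullet> (transpose M *v v) = v \<bullet> (M *v u)"
  for M :: "real^'m^'n"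
  by (metis dot_lmul_matrix inner_commute transpose_matrix_vector)

lemma symmetric_matrix_nth: "transpose M = M \<Longrightarrow> M $ i $ j = M $ j $ i"
  by (metis transpose_def vec_lambda_beta)

lemma quadratic_form_axis: "axis i 1 \<bullet> (M *v axis j 1) = M $ i $ j" for M :: "real^'m^'n"
  by (simp add: inner_axis' matrix_vector_mult_basis column_def)

text \<open>The polynomial \<open>a + 2 * t * b + t\<^sup>2 * c\<close> in \<open>t\<close> is the
  form at \<open>u + t *\<^sub>R v\<close>, hence nonnegative. For \<open>c > 0\<close> its value at
  the minimiser \<open>- b / c\<close> gives the claim; for \<open>c = 0\<close> it is affine in
  \<open>t\<close>, which forces \<open>b = 0\<close>.\<close>

lemma positive_semidefinite_Cauchy_Schwarz:
  assumes "positive_semidefinite M"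
  shows "(u \<bullet> (M *v v))\<^sup>2 \<le> (u \<bullet> (M *v u)) * (v \<bullet> (M *v v))"
proof -
  define a b c where "a = u \<bullet> (M *v u)" and "b = u \<bullet> (M *v v)" and "c = v \<bullet> (M *v v)"
  have sym: "v \<bullet> (M *v u) = b"
    using assms inner_transpose_matrix_vector[of v M u] by (simp add: b_def positive_semidefinite_def del: transpose_matrix_vector)
  have nonneg: "0 \<le> a + 2 * t * b + t\<^sup>2 * c" for t
  proof -
    have "(u + t *\<^sub>R v) \<bullet> (M *v (u + t *\<^sub>R v)) = a + 2 * t * b + t\<^sup>2 * c"
      by (simp add: matrix_vector_right_distrib matrix_vector_mult_scaleR inner_add_left inner_add_right
          sym a_def[symmetric] b_def[symmetric] c_def[symmetric] power2_eq_square algebra_simps)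
    then show ?thesis using assms by (metis positive_semidefinite_def)
  qed
  have "0 \<le> c" using assms by (simp add: positive_semidefinite_def c_def)
  have "b\<^sup>2 \<le> a * c"
  proof (cases "c = 0")
    case True
    have "b = 0"
    proof (rule ccontr)
      assume "b \<noteq> 0"
      \<comment> \<open>At this \<open>t\<close> the affine function \<open>a + 2 * t * b\<close>
        takes the value -1.\<close>
      then have "2 * (- (a + 1) / (2 * b)) * b = - (a + 1)" by simp
      with nonneg[of "- (a + 1) / (2 * b)"] True show False by simp
    qed
    then show ?thesis using True by simp
  next
    case False
    with \<open>0 \<le> c\<close> have "c > 0" by simp
    with nonneg[of "- b / c"] show ?thesis by (simp add: field_simps power2_eq_square)
  qed
  then show ?thesis by (simp add: a_def b_def c_def)
qed

text \<open>Hadamard multiplication by \<open>outer_prod c c\<close> is congruence by the diagonal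
  matrix of \<open>c\<close>, so it preserves nonnegative forms.\<close>

lemma quadratic_form_hadamard_rank_one:
  "v \<bullet> (hadamard (outer_prod c c) M *v v) = (\<chi> i. v $ i * c $ i) \<bullet> (M *v (\<chi> i. v $ i * c $ i))"
  by (simp add: inner_matrix_vector hadamard_def outer_prod_def ac_simps)

lemma quadratic_form_outer_prod:
  "v \<bullet> (outer_prod c c *v v) = (v \<bullet> c)\<^sup>2"
  unfolding inner_matrix_vector outer_prod_def power2_eq_square
  by (simp add: inner_vec_def sum_product ac_simps)

text \<open>Subtracting from \<open>S\<close> the rank-one matrix built from its \<open>k\<close>-th column (a Cholesky step)
  leaves a positive semidefinite matrix with vanishing \<open>k\<close>-th row and column.\<close>

lemma quadratic_form_hadamard_nonneg:
  fixes S T :: "real^'n^'n"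
  assumes "positive_semidefinite S" "positive_semidefinite T"
  shows "0 \<le> v \<bullet> (hadamard S T *v v)"
proof -
  \<comment> \<open>The set \<open>J\<close> contains the indices of all nonzero rows of
    \<open>S\<close>; the induction clears one row and column at a time while \<open>T\<close> stays
    fixed.\<close>
  have "0 \<le> v \<bullet> (hadamard S T *v v)"
    if "finite J" "positive_semidefinite S" "\<And>i j. i \<notin> J \<Longrightarrow> S $ i $ j = 0" for J and S :: "real^'n^'n"
    using that
  proof (induction J arbitrary: S rule: finite_induct)
    case empty
    then have "hadamard S T = 0" by (simp add: hadamard_def vec_eq_iff)
    then show ?case by simp
  next
    case (insert k J)
    define c where "c = S *v axis k 1"
    define d where "d = S $ k $ k"
    have sym: "transpose S = S" using insert.prems(1) by (simp add: positive_semidefinite_def)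
    have c: "c $ i = S $ i $ k" for i
      by (simp add: c_def matrix_vector_mult_basis column_def)
    have CS: "(u \<bullet> c)\<^sup>2 \<le> (u \<bullet> (S *v u)) * d" for u
      using positive_semidefinite_Cauchy_Schwarz[OF insert.prems(1), of u "axis k 1"]
      by (simp add: c_def d_def quadratic_form_axis)
    have "0 \<le> d" using insert.prems(1) unfolding positive_semidefinite_def d_def
      by (metis quadratic_form_axis)
    show ?case
    proof (cases "d = 0")
      case True
      \<comment> \<open>A vanishing diagonal entry kills its whole column by Cauchy-Schwarz, so
        \<open>S\<close> already satisfies the induction hypothesis for \<open>J\<close>.\<close>
      have "c $ i = 0" for i using CS[of "axis i 1"] True by (simp add: inner_axis')
      then have "S $ k $ j = 0" for j using c symmetric_matrix_nth[OF sym] by metis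
      then show ?thesis using insert.IH[of S] insert.prems by (metis insertE)
    next
      case False
      with \<open>0 \<le> d\<close> have "0 < d" by simp
      \<comment> \<open>Nonnegativity of the form of \<open>S'\<close> is the inequality
        \<open>CS\<close> divided by \<open>d\<close>.\<close>
      define S' where "S' = S - (1 / d) *\<^sub>R outer_prod c c"
      have "positive_semidefinite S'"
        unfolding positive_semidefinite_def
      proof (intro conjI allI)
        show "transpose S' = S'"
          using symmetric_matrix_nth[OF sym]
          by (simp add: S'_def transpose_def outer_prod_def vec_eq_iff mult.commute)
        show "0 \<le> v \<bullet> (S' *v v)" for v
          using CS[of v] \<open>0 < d\<close>
          by (simp add: S'_def matrix_vector_mult_diff_rdistrib inner_diff_right
              scaleR_matrix_vector_assoc[symmetric] quadratic_form_outer_prod field_simps)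
      qed
      moreover have "S' $ i $ j = 0" if "i \<notin> J" for i j
      proof (cases "i = k")
        case True
        then show ?thesis
          using \<open>0 < d\<close> symmetric_matrix_nth[OF sym, of k j] by (simp add: S'_def outer_prod_def c d_def)
      next
        case False
        then have "S $ i $ l = 0" for l using that insert.prems(2) by simp
        then show ?thesis by (simp add: S'_def outer_prod_def c)
      qed
      ultimately have "0 \<le> v \<bullet> (hadamard S' T *v v)" by (rule insert.IH)
      moreover have "hadamard S T = hadamard S' T + (1 / d) *\<^sub>R hadamard (outer_prod c c) T"
        by (simp add: S'_def hadamard_def vec_eq_iff algebra_simps)
      moreover have "0 \<le> v \<bullet> (hadamard (outer_prod c c) T *v v)"
        using assms(2) by (simp add: quadratic_form_hadamard_rank_one positive_semidefinite_def)
      ultimately show ?thesis using \<open>0 < d\<close>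
        by (simp add: matrix_vector_mult_add_rdistrib inner_add_right scaleR_matrix_vector_assoc[symmetric])
    qed
  qed
  from this[of UNIV S] assms(1) show ?thesis by simp
qed

section \<open>Inverses of positive definite matrices\<close>

lemma positive_definite_invertible:
  assumes "positive_definite M" shows "invertible M"
proof -
  have "v = 0" if "M *v v = 0" for v
    using assms that unfolding positive_definite_def by (metis inner_zero_right less_irrefl)
  then show ?thesis
    using invertible_left_inverse matrix_left_invertible_ker by blast
qed

lemma
  fixes M :: "real^'n^'n"
  assumes "invertible M"
  shows matrix_inv_right: "M ** matrix_inv M = mat 1"
    and matrix_inv_left: "matrix_inv M ** M = mat 1"
  using someI_ex[of "\<lambda>M'. M ** M' = mat 1 \<and> M' ** M = mat 1"] assms
  unfolding invertible_def matrix_inv_def by auto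

lemma matrix_inv_symmetric:
  fixes M :: "real^'n^'n"
  assumes "transpose M = M" "invertible M"
  shows "transpose (matrix_inv M) = matrix_inv M"
proof -
  have "transpose (matrix_inv M) ** M = mat 1"
    by (metis assms matrix_transpose_mul transpose_mat matrix_inv_right)
  then show ?thesis
    by (metis assms(2) matrix_inv_right matrix_mul_assoc matrix_mul_lid matrix_mul_rid)
qed

lemma positive_definite_matrix_inv:
  assumes "positive_definite M" shows "positive_definite (matrix_inv M)"
  unfolding positive_definite_def
proof (intro conjI allI impI)
  note inv = positive_definite_invertible[OF assms]
  show "transpose (matrix_inv M) = matrix_inv M"
    using matrix_inv_symmetric inv assms by (auto simp: positive_definite_def)
  fix v :: "real^'a" assume "v \<noteq> 0"
  define w where "w = matrix_inv M *v v"
  have v: "v = M *v w" by (simp add: w_def matrix_vector_mul_assoc matrix_inv_right[OF inv])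
  with \<open>v \<noteq> 0\<close> have "w \<noteq> 0" by auto
  then have "w \<bullet> (M *v w) > 0" using assms by (simp add: positive_definite_def)
  then show "v \<bullet> (matrix_inv M *v v) > 0"
    by (metis v w_def inner_commute)
qed

section \<open>Asymptotic stability from a contracting derivative\<close>

text \<open>The derivative may fail to contract the given norm, so contraction is asked of
  \<open>norm (R u)\<close>, which is equivalent to it. Near \<open>x\<close> the linearization
  error uses up only part of the gap between \<open>c\<close> and 1, so distances in the new norm
  decay geometrically.\<close>

lemma locally_asymptotically_stable_linearization:
  fixes f :: "'a::real_normed_vector \<Rightarrow> 'a" and R :: "'a \<Rightarrow> 'b::real_normed_vector"
  assumes "x \<in> S" "f x = x" "f ` S \<subseteq> S"
    and der: "(f has_derivative f') (at x within S)"
    and R: "bounded_linear R" and a: "a > 0" "\<And>u. a * norm u \<le> norm (R u)"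
    and c: "0 \<le> c" "c < 1" "\<And>u. norm (R (f' u)) \<le> c * norm (R u)"
  shows "locally_asymptotically_stable S f x"
  unfolding locally_asymptotically_stable_def
proof (intro conjI allI impI)
  show "x \<in> S" "f x = x" using assms by auto
  fix \<epsilon> :: real assume "\<epsilon> > 0"
  obtain b where b: "b > 0" "\<And>u. norm (R u) \<le> norm u * b"
    using bounded_linear.pos_bounded[OF R] by blast
  interpret R: bounded_linear R by fact
  \<comment> \<open>Midpoint of \<open>c\<close> and 1: half of the gap is left for the
    linearization error.\<close>
  define c' where "c' = (1 + c) / 2"
  have c': "0 \<le> c'" "c' < 1" "c \<le> c'" using c by (auto simp: c'_def)
  \<comment> \<open>Chosen so that the error \<open>e * norm (z - x)\<close>, enlarged by the bound
    \<open>b\<close> of \<open>R\<close>, is at most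
    \<open>(1 - c) / 2 * norm (R (z - x))\<close>.\<close>
  define e where "e = (1 - c) / 2 * a / b"
  have e: "e > 0" using a b c by (simp add: e_def)
  obtain r where r: "r > 0"
    "\<And>z. z \<in> S \<Longrightarrow> norm (z - x) < r \<Longrightarrow> norm (f z - f x - f' (z - x)) \<le> e * norm (z - x)"
    using der e unfolding has_derivative_within_alt by blast
  have step: "norm (R (f z - x)) \<le> c' * norm (R (z - x))" if "z \<in> S" "norm (z - x) < r" for z
  proof -
    have "norm (R (f z - x)) = norm (R (f' (z - x)) + R (f z - f x - f' (z - x)))"
      by (simp add: \<open>f x = x\<close> flip: R.add)
    also have "\<dots> \<le> norm (R (f' (z - x))) + norm (R (f z - f x - f' (z - x)))"
      by (rule norm_triangle_ineq)
    also have "\<dots> \<le> c * norm (R (z - x)) + norm (f z - f x - f' (z - x)) * b"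
      by (intro add_mono c b)
    also have "\<dots> \<le> c * norm (R (z - x)) + (e * norm (z - x)) * b"
      using r(2)[OF that] b by (intro add_mono mult_right_mono) auto
    also have "\<dots> = c * norm (R (z - x)) + (1 - c) / 2 * (a * norm (z - x))"
      using b by (simp add: e_def)
    also have "\<dots> \<le> c * norm (R (z - x)) + (1 - c) / 2 * norm (R (z - x))"
      using a c by (intro add_mono mult_left_mono) auto
    also have "\<dots> = c' * norm (R (z - x))" by (simp add: c'_def field_simps)
    finally show ?thesis .
  qed
  \<comment> \<open>This gives \<open>norm (R (\<psi> 0 - x)) < a * min r \<epsilon>\<close>; the
    lower bound \<open>a\<close> later turns it back into a distance below both \<open>r\<close> and
    \<open>\<epsilon>\<close>.\<close>
  define \<delta> where "\<delta> = a * min r \<epsilon> / b"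
  show "\<exists>\<delta>>0. \<forall>\<psi>. \<psi> 0 \<in> S \<and> (\<forall>t. \<psi> (Suc t) = f (\<psi> t)) \<and> norm (\<psi> 0 - x) < \<delta> \<longrightarrow>
          (\<forall>t. norm (f (\<psi> t) - x) < \<epsilon>) \<and> (\<lambda>t. norm (\<psi> t - x)) \<longlonglongrightarrow> 0"
  proof (intro exI[of _ \<delta>] conjI allI impI)
    show "\<delta> > 0" using a b r \<open>\<epsilon> > 0\<close> by (simp add: \<delta>_def)
  next
    fix \<psi> :: "nat \<Rightarrow> 'a"
    assume H: "\<psi> 0 \<in> S \<and> (\<forall>t. \<psi> (Suc t) = f (\<psi> t)) \<and> norm (\<psi> 0 - x) < \<delta>"
    have R0: "norm (R (\<psi> 0 - x)) < a * min r \<epsilon>"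
      using H b by (intro le_less_trans[OF b(2)]) (simp add: \<delta>_def field_simps)
    have mem: "\<psi> t \<in> S" for t using H assms(3) by (induction t) auto
    \<comment> \<open>Conditional on the decay at time \<open>t\<close>, so that the induction for
      \<open>dec\<close> can check that \<open>\<psi> t\<close> lies within the radius where
      \<open>step\<close> applies.\<close>
    have close: "norm (\<psi> t - x) < min r \<epsilon>"
      if "norm (R (\<psi> t - x)) \<le> c' ^ t * norm (R (\<psi> 0 - x))" for t
    proof -
      have "a * norm (\<psi> t - x) \<le> norm (R (\<psi> t - x))" by (rule a)
      also have "\<dots> \<le> 1 * norm (R (\<psi> 0 - x))"
        using that c' by (intro order_trans[OF that] mult_right_mono power_le_one) auto
      also have "\<dots> < a * min r \<epsilon>" using R0 by simp
      finally show ?thesis using a by simp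
    qed
    have dec: "norm (R (\<psi> t - x)) \<le> c' ^ t * norm (R (\<psi> 0 - x))" for t
    proof (induction t)
      case (Suc t)
      have "norm (R (\<psi> (Suc t) - x)) \<le> c' * norm (R (\<psi> t - x))"
        using H step[OF mem] close[OF Suc] by simp
      also have "\<dots> \<le> c' * (c' ^ t * norm (R (\<psi> 0 - x)))"
        using Suc c' by (intro mult_left_mono) auto
      finally show ?case by simp
    qed simp
    show "norm (f (\<psi> t) - x) < \<epsilon>" for t
      using close[OF dec, of "Suc t"] H by simp
    have "(\<lambda>t. c' ^ t * norm (R (\<psi> 0 - x)) / a) \<longlonglongrightarrow> 0"
      using c' by (intro tendsto_divide_zero tendsto_mult_left_zero LIMSEQ_power_zero) auto
    moreover have "norm (\<psi> t - x) \<le> c' ^ t * norm (R (\<psi> 0 - x)) / a" for t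
      using order_trans[OF a(2) dec[of t]] a(1) by (simp add: field_simps)
    ultimately show "(\<lambda>t. norm (\<psi> t - x)) \<longlonglongrightarrow> 0"
      by (intro Lim_null_comparison[of "\<lambda>t. norm (\<psi> t - x)"]) auto
  qed
qed

text \<open>Testing \<open>P\<close> at \<open>u - z\<close> with u = B P z bounds
  \<open>2 * q\<close> by the sum of the forms at \<open>u\<close> and \<open>z\<close>. The
  hypothesis bounds the first by \<open>q\<close> and the second by the right-hand side. This passes
  from P \<le> 1/B to P B P \<le> 1/B without a root of \<open>P\<close>.\<close>

lemma weighted_norm_positive_semidefinite_le:
  fixes P :: "real^'n^'n" and B :: "real^'n"
  assumes P: "positive_semidefinite P" and B: "\<And>i. 0 < B $ i"
    and le: "\<And>v. v \<bullet> (P *v v) \<le> (\<Sum>i\<in>UNIV. (v $ i)\<^sup>2 / B $ i)"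
  shows "(\<Sum>i\<in>UNIV. B $ i * ((P *v z) $ i)\<^sup>2) \<le> (\<Sum>i\<in>UNIV. (z $ i)\<^sup>2 / B $ i)"
proof -
  define u where "u = (\<chi> i. B $ i * (P *v z) $ i)"
  define q where "q = (\<Sum>i\<in>UNIV. B $ i * ((P *v z) $ i)\<^sup>2)"
  have q: "u \<bullet> (P *v z) = q"
    by (simp add: u_def q_def inner_vec_def power2_eq_square mult.assoc)
  have "(\<Sum>i\<in>UNIV. (u $ i)\<^sup>2 / B $ i) = q"
    unfolding q_def u_def using B
    by (intro sum.cong) (auto simp: power2_eq_square field_simps less_imp_neq[THEN not_sym])
  then have u: "u \<bullet> (P *v u) \<le> q" using le[of u] by simp
  have "z \<bullet> (P *v u) = u \<bullet> (P *v z)"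
    using P inner_transpose_matrix_vector[of z P u]
    by (simp add: positive_semidefinite_def del: transpose_matrix_vector)
  moreover have "0 \<le> (u - z) \<bullet> (P *v (u - z))" using P by (simp add: positive_semidefinite_def)
  ultimately have "2 * q \<le> u \<bullet> (P *v u) + z \<bullet> (P *v z)"
    by (simp add: matrix_vector_mult_diff_distrib inner_diff_left inner_diff_right q)
  with u le[of z] show ?thesis by (simp add: q_def)
qed

lemma diag_matrix_mult_vector: "(diag_matrix b *v v) $ i = b $ i * v $ i"
proof -
  have "(\<Sum>j\<in>UNIV. (if i = j then b $ i else 0) * v $ j) = (\<Sum>j\<in>UNIV. if i = j then b $ i * v $ j else 0)"
    by (intro sum.cong) auto
  then show ?thesis by (simp add: diag_matrix_def matrix_vector_mult_def)
qed

lemma hadamard_add_right: "hadamard M (N + L) = hadamard M N + hadamard M L"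
  and hadamard_scaleR_right: "hadamard M (a *\<^sub>R N) = a *\<^sub>R hadamard M N"
  and hadamard_commute: "hadamard M N = hadamard N M"
  by (simp_all add: hadamard_def vec_eq_iff algebra_simps)

section \<open>Posterior covariance as a function of the weights\<close>

text \<open>Here \<open>\<Lambda>\<close> stands for the prior precision divided by \<alpha>, and
  the argument \<open>b\<close> of the functions below for the weights -2 A(\<xi>); the hyperbolic
  tangent stays out of sight.\<close>

locale gaussian_posterior =
  fixes X :: "real^'p^'n" and \<Lambda> :: "real^'p^'p"
  assumes positive_definite_prior: "positive_definite \<Lambda>"
begin

definition precision :: "real^'n \<Rightarrow> real^'p^'p" where
  "precision b = \<Lambda> + transpose X ** diag_matrix b ** X"

definition cov :: "real^'n \<Rightarrow> real^'p^'p" where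
  "cov b = matrix_inv (precision b)"

definition gram :: "real^'n \<Rightarrow> real^'n^'n" where
  "gram b = X ** cov b ** transpose X"

text \<open>The vector \<open>h\<close> is precision times posterior mean, so
  \<open>cov b *v h\<close> is the mean.\<close>

definition fit :: "real^'p \<Rightarrow> real^'n \<Rightarrow> real^'n" where
  "fit h b = X *v (cov b *v h)"

lemma inner_precision:
  "u \<bullet> (precision b *v v) = u \<bullet> (\<Lambda> *v v) + (\<Sum>i\<in>UNIV. b $ i * (X *v u) $ i * (X *v v) $ i)"
proof -
  have "u \<bullet> (transpose X *v (diag_matrix b *v (X *v v))) = (X *v u) \<bullet> (diag_matrix b *v (X *v v))"
    using inner_transpose_matrix_vector[of u X] by (simp add: inner_commute del: transpose_matrix_vector)
  also have "\<dots> = (\<Sum>i\<in>UNIV. b $ i * (X *v u) $ i * (X *v v) $ i)"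
    by (simp add: inner_vec_def diag_matrix_mult_vector ac_simps)
  finally show ?thesis
    by (simp add: precision_def matrix_vector_mult_add_rdistrib inner_add_right
        matrix_vector_mul_assoc[symmetric] del: transpose_matrix_vector)
qed

context
  fixes b :: "real^'n"
  assumes b: "\<And>i. 0 < b $ i"
begin

lemma positive_definite_precision: "positive_definite (precision b)"
  unfolding positive_definite_def
proof (intro conjI allI impI)
  have "transpose (diag_matrix b) = diag_matrix b"
    by (auto simp: transpose_def diag_matrix_def vec_eq_iff)
  moreover have "transpose \<Lambda> = \<Lambda>" using positive_definite_prior by (simp add: positive_definite_def)
  moreover have "transpose (M + N) = transpose M + transpose N" for M N :: "real^'p^'p"
    by (simp add: transpose_def vec_eq_iff)
  ultimately show "transpose (precision b) = precision b"
    by (simp add: precision_def matrix_transpose_mul matrix_mul_assoc)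
  fix v :: "real^'p" assume "v \<noteq> 0"
  then have "0 < v \<bullet> (\<Lambda> *v v)" using positive_definite_prior by (simp add: positive_definite_def)
  moreover have "0 \<le> (\<Sum>i\<in>UNIV. b $ i * (X *v v) $ i * (X *v v) $ i)"
    using b by (intro sum_nonneg) (simp add: mult.assoc less_imp_le)
  ultimately show "0 < v \<bullet> (precision b *v v)" by (simp add: inner_precision)
qed

lemmas invertible_precision = positive_definite_invertible[OF positive_definite_precision]

lemma positive_definite_cov: "positive_definite (cov b)"
  unfolding cov_def by (intro positive_definite_matrix_inv positive_definite_precision)

lemma transpose_cov: "transpose (cov b) = cov b"
  using positive_definite_cov by (simp add: positive_definite_def)

lemma inner_gram: "v \<bullet> (gram b *v w) = (v v* X) \<bullet> (cov b *v (w v* X))"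
  by (simp add: gram_def matrix_vector_mul_assoc[symmetric] dot_lmul_matrix)

lemma positive_semidefinite_gram: "positive_semidefinite (gram b)"
  unfolding positive_semidefinite_def
proof (intro conjI allI)
  show "transpose (gram b) = gram b"
    by (simp add: gram_def matrix_transpose_mul transpose_cov matrix_mul_assoc)
  show "0 \<le> v \<bullet> (gram b *v v)" for v
    using positive_definite_cov by (cases "v v* X = 0") (auto simp: inner_gram positive_definite_def less_imp_le)
qed

text \<open>With \<open>z = cov b *v (v v* X)\<close>, the form \<open>q\<close> equals both the
  pairing of \<open>v\<close> with \<open>X *v z\<close> and the form of the precision at
  \<open>z\<close>, which dominates the weighted squares of \<open>X *v z\<close>. Young's
  inequality on the pairing gives 2 q at most the right-hand side plus q.\<close>

lemma gram_le_inverse_weights: "v \<bullet> (gram b *v v) \<le> (\<Sum>i\<in>UNIV. (v $ i)\<^sup>2 / b $ i)"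
proof -
  define z where "z = cov b *v (v v* X)"
  define q where "q = v \<bullet> (gram b *v v)"
  have pz: "precision b *v z = v v* X"
    using matrix_inv_right[OF invertible_precision]
    by (simp add: z_def cov_def matrix_vector_mul_assoc)
  have q1: "q = (\<Sum>i\<in>UNIV. v $ i * (X *v z) $ i)"
    unfolding q_def inner_gram z_def[symmetric] by (simp add: dot_lmul_matrix) (simp add: inner_vec_def)
  have "q = z \<bullet> (precision b *v z)"
    unfolding pz q_def inner_gram z_def[symmetric] by (rule inner_commute)
  moreover have "0 \<le> z \<bullet> (\<Lambda> *v z)"
    using positive_definite_prior by (cases "z = 0") (auto simp: positive_definite_def less_imp_le)
  ultimately have q2: "(\<Sum>i\<in>UNIV. b $ i * (X *v z) $ i * (X *v z) $ i) \<le> q"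
    by (simp add: inner_precision)
  have "2 * (v $ i * (X *v z) $ i) \<le> (v $ i)\<^sup>2 / b $ i + b $ i * (X *v z) $ i * (X *v z) $ i" for i
  proof -
    have "0 \<le> (v $ i - b $ i * (X *v z) $ i)\<^sup>2 / b $ i" using b[of i] by simp
    also have "\<dots> = (v $ i)\<^sup>2 / b $ i + b $ i * (X *v z) $ i * (X *v z) $ i - 2 * (v $ i * (X *v z) $ i)"
      using b[of i] by (simp add: field_simps power2_eq_square)
    finally show ?thesis by simp
  qed
  then have "2 * q \<le> (\<Sum>i\<in>UNIV. (v $ i)\<^sup>2 / b $ i) + (\<Sum>i\<in>UNIV. b $ i * (X *v z) $ i * (X *v z) $ i)"
    unfolding q1 sum_distrib_left sum.distrib[symmetric] by (intro sum_mono)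
  with q2 show ?thesis by (simp add: q_def)
qed

text \<open>The entry is the form of the positive definite \<open>cov b\<close> at row
  \<open>i\<close>.\<close>

lemma gram_diag_pos:
  assumes "row i X \<noteq> 0" shows "0 < gram b $ i $ i"
proof -
  have "axis i 1 v* X = row i X"
    by (metis column_def column_transpose matrix_vector_mult_basis transpose_matrix_vector transpose_transpose)
  then have "axis i 1 \<bullet> (gram b *v axis i 1) > 0"
    using assms positive_definite_cov unfolding inner_gram positive_definite_def by simp
  then show ?thesis by (simp add: quadratic_form_axis)
qed

lemma gram_diag_nonneg: "0 \<le> gram b $ i $ i"
  using positive_semidefinite_gram unfolding positive_semidefinite_def by (metis quadratic_form_axis)

text \<open>Cauchy-Schwarz and the diagonal bound give the geometric mean of
  \<open>1 / b $ i\<close> and \<open>1 / b $ j\<close>; the sum dominates it. This crude bound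
  serves the continuity proof, as it stays finite when the weights approach a positive
  limit.\<close>

lemma abs_gram_le: "\<bar>gram b $ i $ j\<bar> \<le> 1 / b $ i + 1 / b $ j"
proof -
  have diag: "gram b $ k $ k \<le> 1 / b $ k" for k
  proof -
    have "(\<Sum>l\<in>UNIV. ((axis k 1 :: real^'n) $ l)\<^sup>2 / b $ l) = (\<Sum>l\<in>UNIV. if l = k then 1 / b $ l else 0)"
      by (intro sum.cong) (auto simp: axis_def)
    then show ?thesis using gram_le_inverse_weights[of "axis k 1"] by (simp add: quadratic_form_axis)
  qed
  have "(gram b $ i $ j)\<^sup>2 \<le> gram b $ i $ i * gram b $ j $ j"
    using positive_semidefinite_Cauchy_Schwarz[OF positive_semidefinite_gram, of "axis i 1" "axis j 1"]
    by (simp add: quadratic_form_axis)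
  also have "\<dots> \<le> (1 / b $ i) * (1 / b $ j)"
    using diag gram_diag_nonneg b by (intro mult_mono) (auto simp: less_imp_le)
  also have "\<dots> \<le> (1 / b $ i + 1 / b $ j)\<^sup>2"
  proof -
    have "x * y \<le> (x + y)\<^sup>2" if "0 < x" "0 < y" for x y :: real
      using mult_pos_pos[OF that] by (simp add: power2_sum add.commute add_nonneg_nonneg add_increasing2)
    from this[of "1 / b $ i" "1 / b $ j"] show ?thesis using b[of i] b[of j] by simp
  qed
  finally have "\<bar>gram b $ i $ j\<bar> \<le> \<bar>1 / b $ i + 1 / b $ j\<bar>" by (simp add: abs_le_square_iff)
  then show ?thesis using b[of i] b[of j] by simp
qed

end

section \<open>Resolvent identities and continuity in the weights\<close>

text \<open>The resolvent identity: the middle factor is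
  \<open>precision b - precision b'\<close>.\<close>

lemma cov_diff:
  assumes "\<And>i. 0 < b $ i" "\<And>i. 0 < b' $ i"
  shows "cov b - cov b' = - (cov b ** (transpose X ** diag_matrix (b - b') ** X) ** cov b')"
proof -
  have sub: "A ** (B - C) = A ** B - A ** C" "(A - B) ** C = A ** C - B ** C"
    for A B C :: "real^'m^'m"
    by (simp_all add: matrix_matrix_mult_def vec_eq_iff algebra_simps sum_subtractf)
  have "diag_matrix (b - b') = diag_matrix b - diag_matrix b'"
    by (simp add: diag_matrix_def vec_eq_iff)
  moreover have "transpose X ** (D - E) ** X = transpose X ** D ** X - transpose X ** E ** X" for D E
    by (simp add: matrix_matrix_mult_def vec_eq_iff algebra_simps sum_subtractf)
  ultimately have "transpose X ** diag_matrix (b - b') ** X = precision b - precision b'"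
    by (simp add: precision_def)
  then have "cov b ** (transpose X ** diag_matrix (b - b') ** X) ** cov b'
      = (cov b ** precision b) ** cov b' - cov b ** (precision b' ** cov b')"
    by (simp add: sub matrix_mul_assoc)
  also have "\<dots> = cov b' - cov b"
    using matrix_inv_left[OF invertible_precision[OF assms(1)]] matrix_inv_right[OF invertible_precision[OF assms(2)]]
    by (simp add: cov_def)
  finally show ?thesis by simp
qed

text \<open>The resolvent identity applied to \<open>h\<close>. Being exact, it supplies continuity
  first and the derivative later.\<close>

lemma fit_diff:
  assumes "\<And>i. 0 < b $ i" "\<And>i. 0 < b' $ i"
  shows "fit h b $ i - fit h b' $ i = - (\<Sum>k\<in>UNIV. gram b $ i $ k * (b $ k - b' $ k) * fit h b' $ k)"
proof -
  have "fit h b - fit h b' = X *v ((cov b - cov b') *v h)"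
    by (simp add: fit_def matrix_vector_mult_diff_distrib matrix_vector_mult_diff_rdistrib)
  also have "\<dots> = - (gram b *v (diag_matrix (b - b') *v fit h b'))"
  proof -
    have neg: "(- M) *v v = - (M *v v)" "N *v (- v) = - (N *v v)" for M :: "real^'p^'p" and v and N :: "real^'p^'n"
      by (simp_all add: matrix_vector_mult_def vec_eq_iff sum_negf)
    show ?thesis
      unfolding cov_diff[OF assms] neg gram_def fit_def by (simp only: matrix_vector_mul_assoc matrix_mul_assoc)
  qed
  finally have "fit h b - fit h b' = - (gram b *v (diag_matrix (b - b') *v fit h b'))" .
  then have "fit h b $ i - fit h b' $ i = - (gram b *v (diag_matrix (b - b') *v fit h b')) $ i"
    by (metis vector_minus_component vector_uminus_component)
  then show ?thesis by (subst (asm) matrix_vector_mult_def) (simp add: diag_matrix_mult_vector mult.assoc)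
qed

text \<open>Makes the columns of \<open>gram\<close> instances of \<open>fit\<close>, so that
  difference formulas and limits carry over.\<close>

lemma gram_nth: "gram b $ i $ j = fit (row j X) b $ i"
proof -
  have "gram b $ i $ j = (gram b *v axis j 1) $ i" by (simp add: matrix_vector_mult_basis column_def)
  also have "\<dots> = fit (row j X) b $ i"
    by (simp only: gram_def fit_def matrix_vector_mul_assoc[symmetric]) (metis column_transpose matrix_vector_mult_basis)
  finally show ?thesis .
qed

text \<open>In \<open>fit_diff\<close> with \<open>c\<close> as second argument,
  \<open>abs_gram_le\<close> keeps the factor \<open>gram (b z)\<close> bounded while the weight
  differences vanish. Continuity of matrix inversion is not invoked.\<close>

lemma tendsto_fit:
  assumes lim: "(b \<longlongrightarrow> c) F" and b: "\<And>z i. 0 < b z $ i" and c: "\<And>i. 0 < c $ i"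
  shows "((\<lambda>z. fit h (b z) $ i) \<longlongrightarrow> fit h c $ i) F"
proof -
  have nth: "((\<lambda>z. b z $ k) \<longlongrightarrow> c $ k) F" for k by (intro tendsto_vec_nth lim)
  have "((\<lambda>z. fit h (b z) $ i - fit h c $ i) \<longlongrightarrow> 0) F"
  proof (rule Lim_null_comparison)
    show "\<forall>\<^sub>F z in F. norm (fit h (b z) $ i - fit h c $ i)
        \<le> (\<Sum>k\<in>UNIV. (1 / b z $ i + 1 / b z $ k) * \<bar>b z $ k - c $ k\<bar> * \<bar>fit h c $ k\<bar>)"
    proof (intro always_eventually allI)
      fix z
      have "norm (fit h (b z) $ i - fit h c $ i)
          \<le> (\<Sum>k\<in>UNIV. \<bar>gram (b z) $ i $ k * (b z $ k - c $ k) * fit h c $ k\<bar>)"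
        unfolding fit_diff[OF b c] by (simp add: sum_abs)
      also have "\<dots> \<le> (\<Sum>k\<in>UNIV. (1 / b z $ i + 1 / b z $ k) * \<bar>b z $ k - c $ k\<bar> * \<bar>fit h c $ k\<bar>)"
        unfolding abs_mult by (intro sum_mono mult_right_mono abs_gram_le b) auto
      finally show "norm (fit h (b z) $ i - fit h c $ i) \<le> \<dots>" .
    qed
    have "((\<lambda>z. \<Sum>k\<in>UNIV. (1 / b z $ i + 1 / b z $ k) * \<bar>b z $ k - c $ k\<bar> * \<bar>fit h c $ k\<bar>)
        \<longlongrightarrow> (\<Sum>k\<in>UNIV. (1 / c $ i + 1 / c $ k) * \<bar>c $ k - c $ k\<bar> * \<bar>fit h c $ k\<bar>)) F"
      using c by (intro tendsto_intros nth) (auto simp: less_imp_neq[THEN not_sym])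
    then show "((\<lambda>z. \<Sum>k\<in>UNIV. (1 / b z $ i + 1 / b z $ k) * \<bar>b z $ k - c $ k\<bar> * \<bar>fit h c $ k\<bar>) \<longlongrightarrow> 0) F"
      by simp
  qed
  then show ?thesis by (rule LIM_zero_cancel)
qed

lemma tendsto_gram:
  assumes "(b \<longlongrightarrow> c) F" "\<And>z i. 0 < b z $ i" "\<And>i. 0 < c $ i"
  shows "((\<lambda>z. gram (b z) $ i $ j) \<longlongrightarrow> gram c $ i $ j) F"
  unfolding gram_nth by (rule tendsto_fit[OF assms])

section \<open>The recursion in terms of the weights, and its sensitivity to them\<close>

definition second_moment :: "real \<Rightarrow> real^'p \<Rightarrow> real^'n \<Rightarrow> real^'n" where
  "second_moment \<alpha> h b = (\<chi> i. gram b $ i $ i / \<alpha> + (fit h b $ i)\<^sup>2)"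

text \<open>Minus the Jacobian of \<open>second_moment \<alpha> h\<close> with respect to
  \<open>b\<close>.\<close>

definition sensitivity :: "real \<Rightarrow> real^'p \<Rightarrow> real^'n \<Rightarrow> real^'n^'n" where
  "sensitivity \<alpha> h b = hadamard (gram b) ((1 / \<alpha>) *\<^sub>R gram b + 2 *\<^sub>R outer_prod (fit h b) (fit h b))"

text \<open>An exact factorization instead of an expansion with remainder: as \<open>b\<close> tends
  to \<open>b'\<close>, the coefficients of \<open>b $ k - b' $ k\<close> tend to minus the entries
  of \<open>sensitivity \<alpha> h b'\<close>.\<close>

lemma second_moment_diff:
  assumes "\<And>i. 0 < b $ i" "\<And>i. 0 < b' $ i"
  shows "second_moment \<alpha> h b $ i - second_moment \<alpha> h b' $ i =
    - (\<Sum>k\<in>UNIV. gram b $ i $ k * (gram b' $ k $ i / \<alpha> + (fit h b $ i + fit h b' $ i) * fit h b' $ k) * (b $ k - b' $ k))"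
proof -
  have "gram b $ i $ i - gram b' $ i $ i = - (\<Sum>k\<in>UNIV. gram b $ i $ k * (b $ k - b' $ k) * gram b' $ k $ i)"
    unfolding gram_nth[of _ _ i] by (rule fit_diff[OF assms])
  moreover have "(fit h b $ i)\<^sup>2 - (fit h b' $ i)\<^sup>2
      = (fit h b $ i + fit h b' $ i) * (fit h b $ i - fit h b' $ i)"
    by (simp add: power2_eq_square algebra_simps)
  ultimately have "second_moment \<alpha> h b $ i - second_moment \<alpha> h b' $ i =
      - (\<Sum>k\<in>UNIV. gram b $ i $ k * (b $ k - b' $ k) * gram b' $ k $ i) / \<alpha>
      + (fit h b $ i + fit h b' $ i) * (- (\<Sum>k\<in>UNIV. gram b $ i $ k * (b $ k - b' $ k) * fit h b' $ k))"
    unfolding fit_diff[OF assms, symmetric]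
    by (metis (no_types, lifting) add_diff_add diff_divide_distrib second_moment_def vec_lambda_beta)
  also have "\<dots> = - (\<Sum>k\<in>UNIV. gram b $ i $ k * (gram b' $ k $ i / \<alpha> + (fit h b $ i + fit h b' $ i) * fit h b' $ k) * (b $ k - b' $ k))"
    unfolding sum_negf[symmetric] sum_divide_distrib sum_distrib_left sum.distrib[symmetric]
    by (intro sum.cong refl) (simp add: algebra_simps add_divide_distrib diff_divide_distrib)
  finally show ?thesis .
qed

lemma inner_sensitivity:
  "v \<bullet> (sensitivity \<alpha> h b *v v) = (v \<bullet> (hadamard (gram b) (gram b) *v v)) / \<alpha>
    + 2 * ((\<chi> i. v $ i * fit h b $ i) \<bullet> (gram b *v (\<chi> i. v $ i * fit h b $ i)))"
  unfolding quadratic_form_hadamard_rank_one[symmetric] hadamard_commute[of "outer_prod _ _"] sensitivity_def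
  by (simp add: hadamard_add_right hadamard_scaleR_right matrix_vector_mult_add_rdistrib inner_add_right
      scaleR_matrix_vector_assoc[symmetric])

lemma positive_semidefinite_sensitivity:
  assumes "\<And>i. 0 < b $ i" "0 < \<alpha>"
  shows "positive_semidefinite (sensitivity \<alpha> h b)"
  unfolding positive_semidefinite_def
proof (intro conjI allI)
  note S = positive_semidefinite_gram[OF assms(1)]
  then have "transpose (gram b) = gram b" by (simp add: positive_semidefinite_def)
  from symmetric_matrix_nth[OF this] show "transpose (sensitivity \<alpha> h b) = sensitivity \<alpha> h b"
    by (simp add: sensitivity_def transpose_def hadamard_def outer_prod_def vec_eq_iff mult.commute)
  show "0 \<le> v \<bullet> (sensitivity \<alpha> h b *v v)" for v
    unfolding inner_sensitivity using quadratic_form_hadamard_nonneg[OF S S] S assms(2)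
    by (simp add: positive_semidefinite_def)
qed

text \<open>The Schur product of \<open>gram b\<close> with the semidefinite diag(1/b) -
  \<open>gram b\<close> bounds the entrywise square of \<open>gram b\<close> by a diagonal matrix.
  The rank-one part is \<open>gram_le_inverse_weights\<close> at the vector rescaled by
  \<open>fit h b\<close>.\<close>

lemma inner_sensitivity_le:
  assumes b: "\<And>i. 0 < b $ i" and "0 < \<alpha>"
  shows "v \<bullet> (sensitivity \<alpha> h b *v v) \<le> (\<Sum>i\<in>UNIV. (v $ i)\<^sup>2 * (2 * second_moment \<alpha> h b $ i / b $ i))"
proof -
  note S = positive_semidefinite_gram[OF b]
  define T where "T = diag_matrix (\<chi> i. 1 / b $ i) - gram b"
  have "positive_semidefinite T"
    unfolding positive_semidefinite_def
  proof (intro conjI allI)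
    show "transpose T = T"
      using S by (auto simp: T_def positive_semidefinite_def transpose_def diag_matrix_def vec_eq_iff)
    have "u \<bullet> (diag_matrix (\<chi> i. 1 / b $ i) *v u) = (\<Sum>i\<in>UNIV. (u $ i)\<^sup>2 / b $ i)" for u
      by (simp add: inner_vec_def diag_matrix_mult_vector power2_eq_square)
    then show "0 \<le> u \<bullet> (T *v u)" for u
      using gram_le_inverse_weights[OF b, of u]
      by (simp add: T_def matrix_vector_mult_diff_rdistrib inner_diff_right)
  qed
  then have "0 \<le> v \<bullet> (hadamard (gram b) T *v v)" by (rule quadratic_form_hadamard_nonneg[OF S])
  also have "hadamard (gram b) T = diag_matrix (\<chi> i. gram b $ i $ i / b $ i) - hadamard (gram b) (gram b)"
    by (simp add: T_def hadamard_def diag_matrix_def vec_eq_iff algebra_simps)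
  finally have "v \<bullet> (hadamard (gram b) (gram b) *v v) \<le> (\<Sum>i\<in>UNIV. (v $ i)\<^sup>2 * (gram b $ i $ i / b $ i))"
    by (simp add: matrix_vector_mult_diff_rdistrib inner_diff_right)
      (simp add: inner_vec_def diag_matrix_mult_vector power2_eq_square ac_simps)
  then have "v \<bullet> (sensitivity \<alpha> h b *v v) \<le> (\<Sum>i\<in>UNIV. (v $ i)\<^sup>2 * (gram b $ i $ i / b $ i)) / \<alpha>
      + 2 * (\<Sum>i\<in>UNIV. (v $ i * fit h b $ i)\<^sup>2 / b $ i)"
    unfolding inner_sensitivity
    using gram_le_inverse_weights[OF b, of "\<chi> i. v $ i * fit h b $ i"] \<open>0 < \<alpha>\<close>
    by (intro add_mono divide_right_mono mult_left_mono) auto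
  also have "\<dots> = (\<Sum>i\<in>UNIV. (v $ i)\<^sup>2 * ((gram b $ i $ i / \<alpha> + 2 * (fit h b $ i)\<^sup>2) / b $ i))"
    by (simp add: sum_divide_distrib sum_distrib_left sum.distrib[symmetric] power_mult_distrib
        distrib_left add_divide_distrib ac_simps)
  \<comment> \<open>Doubling the \<open>gram\<close> term as well produces a multiple of
    \<open>second_moment\<close>, which a fixed point turns into its own coordinate.\<close>
  also have "\<dots> \<le> (\<Sum>i\<in>UNIV. (v $ i)\<^sup>2 * (2 * second_moment \<alpha> h b $ i / b $ i))"
    using b \<open>0 < \<alpha>\<close> gram_diag_nonneg[OF b]
    by (intro sum_mono mult_left_mono divide_right_mono) (auto simp: second_moment_def less_imp_le divide_right_mono)
  finally show ?thesis .
qed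

end

section \<open>Differentiability of the recursion\<close>

text \<open>A Caratheodory criterion: the linear factor vanishes at \<open>x\<close>, so continuity
  of \<open>p\<close> makes the error (p y - p x) L(y - x) of smaller order.\<close>

lemma has_derivative_mult_null:
  fixes p L :: "'a::real_normed_vector \<Rightarrow> real"
  assumes p: "isCont p x" and L: "bounded_linear L"
  shows "((\<lambda>y. p y * L (y - x)) has_derivative (\<lambda>u. p x * L u)) (at x)"
  unfolding has_derivative_iff_norm
proof
  interpret bounded_linear L by fact
  show "bounded_linear (\<lambda>u. p x * L u)" by (rule bounded_linear_const_mult[OF L])
  obtain K where K: "\<And>u. norm (L u) \<le> norm u * K" using pos_bounded by blast
  show "((\<lambda>y. norm (p y * L (y - x) - p x * L (x - x) - p x * L (y - x)) / norm (y - x)) \<longlongrightarrow> 0) (at x)"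
  proof (rule Lim_null_comparison)
    have "norm (p y * L (y - x) - p x * L (y - x)) / norm (y - x) \<le> \<bar>p y - p x\<bar> * K" if "y \<noteq> x" for y
    proof -
      have "norm (p y * L (y - x) - p x * L (y - x)) = \<bar>p y - p x\<bar> * norm (L (y - x))"
        by (simp add: abs_mult flip: left_diff_distrib)
      also have "\<dots> \<le> \<bar>p y - p x\<bar> * (norm (y - x) * K)" by (intro mult_left_mono K) simp
      finally show ?thesis using that by (simp add: field_simps)
    qed
    then show "\<forall>\<^sub>F y in at x. norm (norm (p y * L (y - x) - p x * L (x - x) - p x * L (y - x)) / norm (y - x)) \<le> \<bar>p y - p x\<bar> * K"
      by (auto simp: eventually_at_filter zero)
    have "((\<lambda>y. \<bar>p y - p x\<bar> * K) \<longlongrightarrow> \<bar>p x - p x\<bar> * K) (at x)"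
      using p by (intro tendsto_intros) (simp add: isCont_def)
    then show "((\<lambda>y. \<bar>p y - p x\<bar> * K) \<longlongrightarrow> 0) (at x)" by simp
  qed
qed

context gaussian_posterior
begin

text \<open>Inserting Caratheodory slopes of \<open>\<phi>\<close> into
  \<open>second_moment_diff\<close> writes each component as a constant plus continuous coefficients
  times the coordinates of \<open>\<psi> - x\<close>; \<open>has_derivative_mult_null\<close>
  handles each term.\<close>

lemma has_derivative_second_moment:
  fixes x :: "real^'n"
  assumes \<phi>: "\<And>t. 0 < \<phi> t" and w: "\<And>i. (\<phi> has_real_derivative w $ i) (at (x $ i))"
  shows "((\<lambda>\<psi>. second_moment \<alpha> h (\<chi> i. \<phi> (\<psi> $ i))) has_derivative
    (\<lambda>u. - (sensitivity \<alpha> h (\<chi> i. \<phi> (x $ i)) *v (\<chi> i. w $ i * u $ i)))) (at x)"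
proof -
  define b where "b \<psi> = (\<chi> i. \<phi> (\<psi> $ i))" for \<psi> :: "real^'n"
  have b: "0 < b \<psi> $ i" for \<psi> i by (simp add: b_def \<phi>)
  have "\<forall>i. \<exists>g. (\<forall>z. \<phi> z - \<phi> (x $ i) = g z * (z - x $ i)) \<and> isCont g (x $ i) \<and> g (x $ i) = w $ i"
    using w by (simp add: CARAT_DERIV)
  then obtain g where g: "\<And>i z. \<phi> z - \<phi> (x $ i) = g i z * (z - x $ i)"
    "\<And>i. isCont (g i) (x $ i)" "\<And>i. g i (x $ i) = w $ i"
    by metis
  define p where "p i k \<psi> = - (gram (b \<psi>) $ i $ k *
      (gram (b x) $ k $ i / \<alpha> + (fit h (b \<psi>) $ i + fit h (b x) $ i) * fit h (b x) $ k) * g k (\<psi> $ k))"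
    for i k \<psi>
  have diff: "second_moment \<alpha> h (b \<psi>) $ i
      = second_moment \<alpha> h (b x) $ i + (\<Sum>k\<in>UNIV. p i k \<psi> * (\<psi> - x) $ k)" for \<psi> i
  proof -
    have b_diff: "b \<psi> $ k - b x $ k = g k (\<psi> $ k) * (\<psi> - x) $ k" for k by (simp add: b_def g)
    have "second_moment \<alpha> h (b \<psi>) $ i - second_moment \<alpha> h (b x) $ i
        = (\<Sum>k\<in>UNIV. p i k \<psi> * (\<psi> - x) $ k)"
      unfolding second_moment_diff[OF b b] b_diff p_def by (simp only: sum_negf mult.assoc mult_minus_left)
    then show ?thesis by simp
  qed
  have nth: "isCont (\<lambda>\<psi>. \<psi> $ k) x" for k :: 'n by (intro continuous_intros)
  have lim_b: "(b \<longlongrightarrow> b x) (at x)"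
    unfolding b_def using isCont_o2[OF nth DERIV_isCont[OF w]]
    by (intro vec_tendstoI) (simp add: isCont_def)
  have cont: "isCont (p i k) x" for i k
  proof -
    have "((\<lambda>\<psi>. g k (\<psi> $ k)) \<longlongrightarrow> g k (x $ k)) (at x)"
      using isCont_o2[OF nth g(2)] by (simp add: isCont_def)
    then show ?thesis
      unfolding isCont_def p_def divide_inverse
      by (intro tendsto_intros tendsto_gram tendsto_fit lim_b b)
  qed
  \<comment> \<open>At \<open>x\<close> the two fits coincide, which yields the factor 2 in
    \<open>sensitivity\<close>; symmetry of \<open>gram\<close> matches the index order.\<close>
  have px: "p i k x = - (sensitivity \<alpha> h (b x) $ i $ k * w $ k)" for i k
  proof -
    have "gram (b x) $ k $ i = gram (b x) $ i $ k"
      using positive_semidefinite_gram[OF b] by (intro symmetric_matrix_nth) (simp add: positive_semidefinite_def)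
    then show ?thesis
      by (simp add: p_def g(3) sensitivity_def hadamard_def outer_prod_def algebra_simps)
  qed
  have "((\<lambda>\<psi>. second_moment \<alpha> h (b x) $ i + (\<Sum>k\<in>UNIV. p i k \<psi> * (\<psi> - x) $ k))
      has_derivative (\<lambda>u. 0 + (\<Sum>k\<in>UNIV. p i k x * u $ k))) (at x)" for i
    by (intro has_derivative_add has_derivative_sum has_derivative_const
        has_derivative_mult_null cont bounded_linear_vec_nth)
  then have "((\<lambda>\<psi>. second_moment \<alpha> h (b \<psi>) $ i) has_derivative
      (\<lambda>u. 0 + (\<Sum>k\<in>UNIV. p i k x * u $ k))) (at x)" for i
    by (subst ext[OF diff])
  then have "((\<lambda>\<psi>. second_moment \<alpha> h (b \<psi>) $ i) has_derivative
      (\<lambda>u. (- (sensitivity \<alpha> h (b x) *v (\<chi> i. w $ i * u $ i))) $ i)) (at x)" for i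
    unfolding px by (simp add: matrix_vector_mult_def sum_negf mult.assoc)
  then show ?thesis
    unfolding b_def
    by (subst has_derivative_componentwise_within) (auto simp: Basis_vec_def inner_axis)
qed

section \<open>Contraction at a positive fixed point\<close>

text \<open>The fixed-point equation puts \<open>x\<close> for \<open>second_moment\<close> in
  \<open>inner_sensitivity_le\<close>, so \<open>P\<close> lies below the inverse of the diagonal
  \<open>B\<close>. The slope condition says that each ratio |w|/B is below 1, which makes the
  derivative a strict contraction in the norm weighted by \<open>B\<close>.\<close>

theorem locally_asymptotically_stable_second_moment:
  fixes x :: "real^'n"
  assumes \<alpha>: "0 < \<alpha>" and \<phi>: "\<And>t. 0 < \<phi> t" and x: "\<And>i. 0 < x $ i"
    and w: "\<And>i. (\<phi> has_real_derivative w $ i) (at (x $ i))" "\<And>i. 2 * x $ i * \<bar>w $ i\<bar> < \<phi> (x $ i)"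
    and fixpoint: "second_moment \<alpha> h (\<chi> i. \<phi> (x $ i)) = x"
  shows "locally_asymptotically_stable {\<psi>. \<forall>i. 0 \<le> \<psi> $ i}
    (\<lambda>\<psi>. second_moment \<alpha> h (\<chi> i. \<phi> (\<psi> $ i))) x"
proof -
  define b where "b = (\<chi> i. \<phi> (x $ i))"
  define P where "P = sensitivity \<alpha> h b"
  have b: "0 < b $ i" for i by (simp add: b_def \<phi>)
  define B where "B = (\<chi> i. b $ i / (2 * x $ i))"
  have B: "0 < B $ i" for i using b x by (simp add: B_def)
  define R where "R u = (\<chi> i. sqrt (B $ i) * u $ i)" for u :: "real^'n"
  have norm_R: "norm (R u) = sqrt (\<Sum>i\<in>UNIV. B $ i * (u $ i)\<^sup>2)" for u
    using B by (simp add: R_def norm_vec_def L2_set_def power_mult_distrib less_imp_le)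
  have lin: "linear R"
    by (rule linearI) (simp_all add: R_def vec_eq_iff algebra_simps)
  have "inj R"
  proof (rule injI)
    fix u v assume "R u = R v"
    then have "sqrt (B $ i) * u $ i = sqrt (B $ i) * v $ i" for i
      by (simp add: R_def vec_eq_iff)
    moreover have "sqrt (B $ i) \<noteq> 0" for i using B[of i] by simp
    ultimately show "u = v" by (simp add: vec_eq_iff)
  qed
  from linear_inj_bounded_below_pos[OF lin this]
  obtain a where a: "a > 0" "\<And>u. a * norm u \<le> norm (R u)" by blast
  define c where "c = Max (range (\<lambda>i. \<bar>w $ i\<bar> / B $ i))"
  have c_ge: "\<bar>w $ i\<bar> / B $ i \<le> c" for i by (auto simp: c_def)
  \<comment> \<open>Here \<open>undefined\<close> is just some index, to exhibit one nonnegative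
    ratio.\<close>
  have c0: "0 \<le> c" using c_ge[of undefined] B[of undefined] by (smt (verit) divide_nonneg_pos)
  have "\<bar>w $ i\<bar> / B $ i < 1" for i
    using w(2)[of i] x[of i] b[of i] by (simp add: B_def b_def field_simps)
  then have c1: "c < 1" by (simp add: c_def)
  have P: "positive_semidefinite P" unfolding P_def by (rule positive_semidefinite_sensitivity[OF b \<alpha>])
  have "v \<bullet> (P *v v) \<le> (\<Sum>i\<in>UNIV. (v $ i)\<^sup>2 / B $ i)" for v
    using inner_sensitivity_le[OF b \<alpha>, of v h]
    by (simp add: P_def B_def fixpoint[folded b_def])
  note weighted = weighted_norm_positive_semidefinite_le[OF P B this]
  show ?thesis
  proof (rule locally_asymptotically_stable_linearization)
    show "((\<lambda>\<psi>. second_moment \<alpha> h (\<chi> i. \<phi> (\<psi> $ i))) has_derivative (\<lambda>u. - (P *v (\<chi> i. w $ i * u $ i))))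
        (at x within {\<psi>. \<forall>i. 0 \<le> \<psi> $ i})"
      unfolding P_def b_def using has_derivative_second_moment[OF \<phi> w(1)] by (rule has_derivative_at_withinI)
    show "bounded_linear R" using lin by (rule linear_conv_bounded_linear[THEN iffD1])
    show "(\<lambda>\<psi>. second_moment \<alpha> h (\<chi> i. \<phi> (\<psi> $ i))) ` {\<psi>. \<forall>i. 0 \<le> \<psi> $ i} \<subseteq> {\<psi>. \<forall>i. 0 \<le> \<psi> $ i}"
      using gram_diag_nonneg \<phi> \<alpha> by (auto simp: second_moment_def)
    show "norm (R (- (P *v (\<chi> i. w $ i * u $ i)))) \<le> c * norm (R u)" for u
    proof -
      \<comment> \<open>The weighted inequality absorbs \<open>P\<close>; the remaining comparison
        is diagonal and costs the factor \<open>c\<^sup>2\<close>.\<close>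
      have "(\<Sum>i\<in>UNIV. B $ i * ((P *v (\<chi> i. w $ i * u $ i)) $ i)\<^sup>2)
          \<le> (\<Sum>i\<in>UNIV. (w $ i * u $ i)\<^sup>2 / B $ i)"
        using weighted[of "\<chi> i. w $ i * u $ i"] by simp
      also have "\<dots> \<le> (\<Sum>i\<in>UNIV. c\<^sup>2 * (B $ i * (u $ i)\<^sup>2))"
      proof (rule sum_mono)
        fix i
        have "(\<bar>w $ i\<bar> / B $ i)\<^sup>2 \<le> c\<^sup>2" using c_ge[of i] B[of i] by (intro power_mono) auto
        then have "(\<bar>w $ i\<bar> / B $ i)\<^sup>2 * (B $ i * (u $ i)\<^sup>2) \<le> c\<^sup>2 * (B $ i * (u $ i)\<^sup>2)"
          using B[of i] by (intro mult_right_mono) auto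
        moreover have "(\<bar>w $ i\<bar> / B $ i)\<^sup>2 * (B $ i * (u $ i)\<^sup>2) = (w $ i * u $ i)\<^sup>2 / B $ i"
          using B[of i] by (simp add: power2_eq_square)
        ultimately show "(w $ i * u $ i)\<^sup>2 / B $ i \<le> c\<^sup>2 * (B $ i * (u $ i)\<^sup>2)" by simp
      qed
      finally have "sqrt (\<Sum>i\<in>UNIV. B $ i * ((P *v (\<chi> i. w $ i * u $ i)) $ i)\<^sup>2)
          \<le> sqrt (c\<^sup>2 * (\<Sum>i\<in>UNIV. B $ i * (u $ i)\<^sup>2))"
        by (simp add: sum_distrib_left)
      then show ?thesis
        using c0 by (simp add: norm_R real_sqrt_mult)
    qed
  qed (use a c0 c1 x fixpoint in \<open>auto simp: less_imp_le\<close>)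
qed

end

section \<open>The weight function -2 A(sqrt t)\<close>

text \<open>\<open>tanh\<close> has the sign of its argument. Negative arguments occur because
  \<open>sqrt\<close> is odd on the reals, so weights are positive for states outside the orthant
  too.\<close>

lemma A_fun_neg: "A_fun t < 0"
proof -
  have "0 < tanh (t / 2) / (4 * t)" if "t \<noteq> 0"
    using that by (cases "t > 0") (auto intro: divide_pos_pos divide_neg_neg)
  then show ?thesis by (simp add: A_fun_def)
qed

text \<open>Since 2 t w = (1 - T^2)/4 - T/(2r) and the weight is T/(2r), the bound amounts to 0 < (1
  - T^2)/4 < T/r. In terms of E = exp r the second inequality is r E < E^2 - 1, which follows from 1
  + r \<le> E.\<close>

lemma A_fun_sqrt_derivative:
  assumes "0 < t"
  obtains w where "((\<lambda>t. - 2 * A_fun (sqrt t)) has_real_derivative w) (at t)"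
    "2 * t * \<bar>w\<bar> < - 2 * A_fun (sqrt t)"
proof -
  define r where "r = sqrt t"
  define T where "T = tanh (r / 2)"
  \<comment> \<open>Closed form of the weight for positive arguments, free of the case distinction
    in \<open>A_fun\<close>.\<close>
  define \<phi> where "\<phi> = (\<lambda>t. tanh (sqrt t / 2) / (2 * sqrt t))"
  have r: "r > 0" "t = r\<^sup>2" using assms by (auto simp: r_def)
  have \<phi>: "- 2 * A_fun (sqrt s) = \<phi> s" if "s > 0" for s
    using that by (simp add: A_fun_def \<phi>_def)
  define w where "w = ((1 - T\<^sup>2) / 4 - T / (2 * r)) / (2 * t)"
  have sqrt_mult: "sqrt t * (sqrt t * z) = t * z" for z
    using assms by (simp flip: mult.assoc)
  have "(\<phi> has_real_derivative w) (at t)"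
    unfolding \<phi>_def using assms r(1)
    by (auto intro!: derivative_eq_intros simp: w_def T_def r_def field_simps power2_eq_square sqrt_mult)
  then have der: "((\<lambda>t. - 2 * A_fun (sqrt t)) has_real_derivative w) (at t)"
  proof (rule has_field_derivative_transform_within[OF _ assms])
    show "\<phi> s = - 2 * A_fun (sqrt s)" if "dist s t < t" for s
      using \<phi>[of s] that by (simp add: dist_real_def abs_less_iff)
  qed simp
  define E where "E = exp r"
  have E: "1 + r \<le> E" by (simp add: E_def)
  have T: "T = (E - 1) / (E + 1)"
  proof -
    have "1 - exp (- r) = (E - 1) / E" "1 + exp (- r) = (E + 1) / E"
      by (simp_all add: E_def exp_minus field_simps)
    moreover have "E \<noteq> 0" by (simp add: E_def)
    ultimately show ?thesis by (simp add: T_def tanh_real_altdef)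
  qed
  have T1: "1 - T\<^sup>2 = 4 * E / (E + 1)\<^sup>2"
  proof -
    have "1 - T\<^sup>2 = ((E + 1)\<^sup>2 - (E - 1)\<^sup>2) / (E + 1)\<^sup>2"
      using E r unfolding T power_divide diff_divide_distrib[of "(E + 1)\<^sup>2"] by simp
    also have "(E + 1)\<^sup>2 - (E - 1)\<^sup>2 = 4 * E" by (simp add: power2_eq_square algebra_simps)
    finally show ?thesis .
  qed
  have "r * E \<le> (E - 1) * E" using E r by (intro mult_right_mono) auto
  also have "\<dots> < (E - 1) * (E + 1)" using E r by (intro mult_strict_left_mono) auto
  finally have "r * E / (E + 1)\<^sup>2 < (E - 1) * (E + 1) / (E + 1)\<^sup>2"
    using E r by (intro divide_strict_right_mono) auto
  also have "\<dots> = T" using E r by (simp add: T power2_eq_square)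
  finally have "(1 - T\<^sup>2) / 4 < T / r" using r by (simp add: T1 field_simps)
  moreover have "0 < (1 - T\<^sup>2) / 4" unfolding T1 using E r by simp
  ultimately have "\<bar>2 * t * w\<bar> < T / (2 * r)"
  proof -
    have "2 * t * w = (1 - T\<^sup>2) / 4 - T / (2 * r)" using assms by (simp add: w_def)
    moreover have "T / r = 2 * (T / (2 * r))" by simp
    ultimately show ?thesis using \<open>(1 - T\<^sup>2) / 4 < T / r\<close> \<open>0 < (1 - T\<^sup>2) / 4\<close> by linarith
  qed
  moreover have "- 2 * A_fun (sqrt t) = T / (2 * r)" using \<phi>[OF assms] by (simp add: \<phi>_def T_def r_def)
  ultimately show ?thesis using assms by (intro that[OF der]) (simp add: abs_mult)
qed

section \<open>The EM recursion as an instance\<close>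

theorem theorem4p1:
  fixes X :: "real^'p^'n"
    and y :: "real^'n"
    and \<mu>\<^sub>\<beta> :: "real^'p"
    and \<Sigma>\<^sub>\<beta> :: "real^'p^'p"
    and \<alpha> :: real
    and \<xi> :: "real^'n"
  assumes "\<And>i. row i X \<noteq> 0"
    and "\<And>i. y $ i \<in> {0, 1}"
    and "\<alpha> \<in> {0<..1}"
    and "positive_definite \<Sigma>\<^sub>\<beta>"
    and "\<And>i. 0 \<le> \<xi> $ i"
    and "vec_square \<xi> = em_rhs X y \<mu>\<^sub>\<beta> \<Sigma>\<^sub>\<beta> \<alpha> \<xi>"
  shows "locally_asymptotically_stable {\<psi>. \<forall>i. 0 \<le> \<psi> $ i}
           (em_map X y \<mu>\<^sub>\<beta> \<Sigma>\<^sub>\<beta> \<alpha>) (vec_square \<xi>)"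
proof -
  have \<alpha>: "0 < \<alpha>" using assms(3) by simp
  define \<phi> where "\<phi> t = - 2 * A_fun (sqrt t)" for t
  have \<phi>: "0 < \<phi> t" for t using A_fun_neg by (simp add: \<phi>_def)
  define \<Lambda> where "\<Lambda> = matrix_inv \<Sigma>\<^sub>\<beta> /\<^sub>R \<alpha>"
  interpret gaussian_posterior X \<Lambda>
  proof
    show "positive_definite \<Lambda>"
      using positive_definite_matrix_inv[OF assms(4)] \<alpha>
      by (simp add: \<Lambda>_def positive_definite_def transpose_scalar scaleR_matrix_vector_assoc[symmetric])
  qed
  \<comment> \<open>Precision times posterior mean does not depend on \<xi>, so one \<open>h\<close>
    serves every state.\<close>
  define h where "h = (y - (\<chi> i. 1 / 2)) v* X + (\<mu>\<^sub>\<beta> v* matrix_inv \<Sigma>\<^sub>\<beta>) /\<^sub>R \<alpha>"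
  define x where "x = vec_square \<xi>"
  \<comment> \<open>The weights are positive at every state, so the two maps agree on the whole
    space and can be exchanged as functions.\<close>
  have em: "em_map X y \<mu>\<^sub>\<beta> \<Sigma>\<^sub>\<beta> \<alpha> = (\<lambda>\<psi>. second_moment \<alpha> h (\<chi> i. \<phi> (\<psi> $ i)))"
  proof
    fix \<psi> :: "real^'n"
    define b where "b = (\<chi> i. \<phi> (\<psi> $ i))"
    have b: "0 < b $ i" for i by (simp add: b_def \<phi>)
    have "diag_matrix b = - 2 *\<^sub>R diag_matrix (\<chi> i. A_fun (vec_sqrt \<psi> $ i))"
      by (simp add: diag_matrix_def vec_eq_iff b_def \<phi>_def vec_sqrt_def)
    moreover have "transpose X ** (- 2 *\<^sub>R D) ** X = - 2 *\<^sub>R (transpose X ** D ** X)" for D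
      by (simp add: matrix_matrix_mult_def vec_eq_iff sum_distrib_left sum_distrib_right sum_negf mult.assoc mult.left_commute)
    ultimately have Sigma: "Sigma_mat X \<Sigma>\<^sub>\<beta> \<alpha> (vec_sqrt \<psi>) = cov b"
      by (simp add: Sigma_mat_def Sigma_inv_def cov_def precision_def \<Lambda>_def[symmetric])
    define m where "m = cov b *v h"
    have mu: "mu_vec X y \<mu>\<^sub>\<beta> \<Sigma>\<^sub>\<beta> \<alpha> (vec_sqrt \<psi>) = m"
      unfolding mu_vec_def Sigma h_def[symmetric] m_def
      by (metis transpose_cov[OF b] transpose_matrix_vector)
    have "em_map X y \<mu>\<^sub>\<beta> \<Sigma>\<^sub>\<beta> \<alpha> \<psi> $ i = second_moment \<alpha> h b $ i" for i
    proof -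
      have "X ** (cov b /\<^sub>R \<alpha> + M) ** transpose X = gram b /\<^sub>R \<alpha> + X ** M ** transpose X" for M
        by (simp add: gram_def matrix_matrix_mult_def vec_eq_iff sum_distrib_left sum_distrib_right
            sum.distrib[symmetric] algebra_simps)
      moreover have "(X ** outer_prod m m ** transpose X) $ i $ i = ((X *v m) $ i)\<^sup>2"
        by (simp add: matrix_matrix_mult_def outer_prod_def matrix_vector_mult_def transpose_def
            power2_eq_square sum_product sum_distrib_right sum_distrib_left ac_simps)
      ultimately show ?thesis
        by (simp add: em_map_def em_rhs_def Sigma mu diag_entries_def second_moment_def fit_def
            m_def[symmetric] divide_inverse mult.commute)
    qed
    then show "em_map X y \<mu>\<^sub>\<beta> \<Sigma>\<^sub>\<beta> \<alpha> \<psi> = second_moment \<alpha> h (\<chi> i. \<phi> (\<psi> $ i))"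
      by (simp add: b_def vec_eq_iff)
  qed
  \<comment> \<open>Nonnegative coordinates of \<xi> let the square root undo the square.\<close>
  have "vec_sqrt x = \<xi>" using assms(5) by (simp add: x_def vec_sqrt_def vec_square_def vec_eq_iff)
  then have fixpoint: "second_moment \<alpha> h (\<chi> i. \<phi> (x $ i)) = x"
    using assms(6) fun_cong[OF em, of x] by (simp add: em_map_def x_def)
  \<comment> \<open>Nonzero rows enter here: positivity permits differentiating \<open>sqrt\<close>
    at \<open>x $ i\<close> and dividing by it in the weighted norm.\<close>
  have x: "0 < x $ i" for i
  proof -
    have "0 < gram (\<chi> i. \<phi> (x $ i)) $ i $ i" using \<phi> assms(1) by (intro gram_diag_pos) auto
    then have "0 < second_moment \<alpha> h (\<chi> i. \<phi> (x $ i)) $ i"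
      using \<alpha> by (simp add: second_moment_def add_pos_nonneg)
    then show ?thesis by (simp add: fixpoint)
  qed
  have "\<exists>w. (\<phi> has_real_derivative w) (at (x $ i)) \<and> 2 * x $ i * \<bar>w\<bar> < \<phi> (x $ i)" for i
    using A_fun_sqrt_derivative[OF x[of i]] unfolding \<phi>_def by metis
  then obtain w where w: "\<And>i. (\<phi> has_real_derivative w i) (at (x $ i))" "\<And>i. 2 * x $ i * \<bar>w i\<bar> < \<phi> (x $ i)"
    by metis
  show ?thesis
    unfolding em x_def[symmetric]
    by (rule locally_asymptotically_stable_second_moment[OF \<alpha> \<phi> x _ _ fixpoint, of "\<chi> i. w i"]) (simp_all add: w)
qed

end
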